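(* Let $\bar x\in\mathcal{F}$ be feasible for the constraint system $F(x)\in\Omega$. If the weak directional metric subregularity constraint qualification (WDMSCQ) is satisfied at $\bar x$, then the generalized Guignard constraint qualification (GGCQ) is satisfied at $\bar x$.
   Context: Data: $F:\mathbb{R}^n\to\mathbb{R}^m$ is continuously differentiable, $\Omega\subset\mathbb{R}^m$ is a union of finitely many convex polyhedra, $\mathcal{F}=\{x : F(x)\in\Omega\}$, and $M:\mathbb{R}^n\rightrightarrows\mathbb{R}^m$ is the multifunction $M(x)=F(x)-\Omega$. For a closed set $C\subset\mathbb{R}^d$ and $z\in C$: $T(z;C)=\{w : \exists\, w_k\to w,\ t_k\downarrow 0,\ z+t_kw_k\in C\}$ (contingent cone); $\hat N(z;C)=\{\xi : \limsup_{z'\to z,\ z'\in C}\xi^T(z'-z)/\|z'-z\|\le 0\}$ (Fréchet normal cone). Linearized cone: $T_{\rm lin}(\bar x)=\{u\in\mathbb{R}^n : \nabla F(\bar x)u\in T(F(\bar x);\Omega)\}$. Directional metric subregularity: for $\rho,\delta>0$ let $V_{\rho,\delta}(u)=\{z : \|z\|\le\rho,\ \big\|\,\|u\|z-\|z\|u\,\big\|\le\delta\|z\|\|u\|\}$. $M$ is metrically subregular in direction $u$ at $(\bar x,0)$ if there are $\rho,\delta,\kappa>0$ such that ${\rm d}(x,M^{-1}(0))\le\kappa\,{\rm d}(0,M(x))$ for all $x\in\bar x+V_{\rho,\delta}(u)$. WDMSCQ is satisfied at $\bar x$ if there is a finite set $\mathcal{U}=\{u_1,\dots,u_N\}\subset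 T_{\rm lin}(\bar x)$ generating ${\rm conv}\,T_{\rm lin}(\bar x)$, i.e. ${\rm conv}\,T_{\rm lin}(\bar x)=\{\sum_{i=1}^N\alpha_iu_i : \alpha_i\ge 0\}$, such that $M$ is metrically subregular in every direction $u\in\mathcal{U}$ at $(\bar x,0)$. GGCQ is satisfied at $\bar x$ if $\hat N(\bar x;\mathcal{F})=\hat N(0;T_{\rm lin}(\bar x))$. *)

theory Defs
  imports "HOL-Analysis.Analysis"
begin

definition continuously_differentiable ::
    "('a::real_normed_vector \<Rightarrow> 'b::real_normed_vector) \<Rightarrow> bool" where
  "continuously_differentiable F \<longleftrightarrow>
     (\<exists>F' :: 'a \<Rightarrow> 'a \<Rightarrow>\<^sub>L 'b.
        (\<forall>x. (F has_derivative blinfun_apply (F' x)) (at x)) \<and> continuous_on UNIV F')"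

definition contingent_cone ::
    "'a::real_normed_vector \<Rightarrow> 'a set \<Rightarrow> 'a set" where
  "contingent_cone z C =
     {v. \<exists>(w :: nat \<Rightarrow> 'a) (t :: nat \<Rightarrow> real).
           w \<longlonglongrightarrow> v \<and> (\<forall>k. 0 < t k) \<and> t \<longlonglongrightarrow> 0 \<and> (\<forall>k. z + t k *\<^sub>R w k \<in> C)}"

(* Meant for z in C. If z is an isolated point of C, the Limsup is that of the trivial
   filter, i.e. minus infinity, and the normal cone is the whole space. *)
definition frechet_normal_cone ::
    "'a::real_inner \<Rightarrow> 'a set \<Rightarrow> 'a set" where
  "frechet_normal_cone z C =
     {\<xi>. Limsup (at z within C) (\<lambda>z'. ereal (\<xi> \<bullet> (z' - z) / norm (z' - z))) \<le> 0}"

definition feasible_set :: "('a \<Rightarrow> 'b) \<Rightarrow> 'b set \<Rightarrow> 'a set" where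
  "feasible_set F \<Omega> = {x. F x \<in> \<Omega>}"

definition constraint_map ::
    "('a \<Rightarrow> 'b::ab_group_add) \<Rightarrow> 'b set \<Rightarrow> 'a \<Rightarrow> 'b set" where
  "constraint_map F \<Omega> x = (\<lambda>\<omega>. F x - \<omega>) ` \<Omega>"

definition linearized_cone ::
    "('a::real_normed_vector \<Rightarrow> 'b::real_normed_vector) \<Rightarrow> 'b set \<Rightarrow> 'a \<Rightarrow> 'a set" where
  "linearized_cone F \<Omega> xbar =
     {u. frechet_derivative F (at xbar) u \<in> contingent_cone (F xbar) \<Omega>}"

definition dir_nbhd ::
    "real \<Rightarrow> real \<Rightarrow> 'a::real_normed_vector \<Rightarrow> 'a set" where
  "dir_nbhd \<rho> \<delta> u =
     {z. norm z \<le> \<rho> \<and> norm (norm u *\<^sub>R z - norm z *\<^sub>R u) \<le> \<delta> * norm z * norm u}"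

(* Metric subregularity of M in direction u at (xbar, 0).
   Meant for M with nonempty values and 0 in M xbar, so that neither distance is taken
   to the empty set (where infdist is 0 rather than infinity). *)
definition metrically_subregular_dir ::
    "('a::real_normed_vector \<Rightarrow> 'b::real_normed_vector set) \<Rightarrow> 'a \<Rightarrow> 'a \<Rightarrow> bool" where
  "metrically_subregular_dir M xbar u \<longleftrightarrow>
     (\<exists>\<rho>>0. \<exists>\<delta>>0. \<exists>\<kappa>>0. \<forall>x \<in> (\<lambda>z. xbar + z) ` dir_nbhd \<rho> \<delta> u.
        infdist x {x'. 0 \<in> M x'} \<le> \<kappa> * infdist 0 (M x))"

definition WDMSCQ ::
    "('a::real_normed_vector \<Rightarrow> 'b::real_normed_vector) \<Rightarrow> 'b set \<Rightarrow> 'a \<Rightarrow> bool" where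
  "WDMSCQ F \<Omega> xbar \<longleftrightarrow>
     (\<exists>U. finite U \<and> U \<subseteq> linearized_cone F \<Omega> xbar \<and>
        convex hull (linearized_cone F \<Omega> xbar) =
          {(\<Sum>u\<in>U. \<alpha> u *\<^sub>R u) |\<alpha>. \<forall>u\<in>U. 0 \<le> \<alpha> u} \<and>
        (\<forall>u\<in>U. metrically_subregular_dir (constraint_map F \<Omega>) xbar u))"

definition GGCQ ::
    "('a::real_inner \<Rightarrow> 'b::real_normed_vector) \<Rightarrow> 'b set \<Rightarrow> 'a \<Rightarrow> bool" where
  "GGCQ F \<Omega> xbar \<longleftrightarrow>
     frechet_normal_cone xbar (feasible_set F \<Omega>) =
     frechet_normal_cone 0 (linearized_cone F \<Omega> xbar)"

end

theory Submission
  imports Defs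
begin

text \<open>In finite dimensions the Frechet normal cone is the polar of the contingent cone, so it
  suffices to compare the contingent cone \<open>T\<close> of the feasible set with the linearized cone.
  Differentiability puts \<open>T\<close> inside the linearized cone. Conversely, if \<open>M\<close> is metrically
  subregular in a direction \<open>u\<close> of the linearized cone, the points \<open>xbar + t\<^sub>k u\<close> have residual
  \<open>o(t\<^sub>k)\<close> along the sequence \<open>t\<^sub>k\<close> that witnesses the tangency of the image of \<open>u\<close> to \<open>\<Omega>\<close>; hence
  they lie within \<open>o(t\<^sub>k)\<close> of the feasible set, and \<open>u \<in> T\<close>. So a normal to the feasible set is
  nonpositive on the generators, and therefore on the whole linearized cone.\<close>

text \<open>Trades the extended-real \<open>Limsup\<close> for real bounds that can be composed with
  sequences. At an isolated point of \<open>C\<close> the filter is trivial and both sides hold for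
  every \<xi>.\<close>

lemma frechet_normal_cone_iff:
  "\<xi> \<in> frechet_normal_cone z C \<longleftrightarrow>
     (\<forall>e>0. \<forall>\<^sub>F z' in at z within C. \<xi> \<bullet> (z' - z) / norm (z' - z) < e)"
  (is "_ \<longleftrightarrow> (\<forall>e>0. eventually (\<lambda>z'. ?q z' < e) ?F)")
proof
  assume "\<xi> \<in> frechet_normal_cone z C"
  then have *: "Limsup ?F (\<lambda>z'. ereal (?q z')) \<le> 0"
    by (simp add: frechet_normal_cone_def)
  show "\<forall>e>0. eventually (\<lambda>z'. ?q z' < e) ?F"
  proof (intro allI impI)
    fix e :: real
    assume "0 < e"
    then have "Limsup ?F (\<lambda>z'. ereal (?q z')) < ereal e"
      using * by (metis ereal_less(2) le_less_trans)
    from Limsup_lessD[OF this] show "eventually (\<lambda>z'. ?q z' < e) ?F" by simp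
  qed
next
  assume *: "\<forall>e>0. eventually (\<lambda>z'. ?q z' < e) ?F"
  have "Limsup ?F (\<lambda>z'. ereal (?q z')) \<le> 0 + ereal e" if "0 < e" for e
    using *[rule_format, OF that]
    by (intro Limsup_bounded) (auto elim!: eventually_mono simp: less_imp_le)
  then have "Limsup ?F (\<lambda>z'. ereal (?q z')) \<le> 0"
    by (rule ereal_le_epsilon2)
  then show "\<xi> \<in> frechet_normal_cone z C"
    by (simp add: frechet_normal_cone_def)
qed

text \<open>A tangent vector supplies a sequence in \<open>C\<close> along which the normal quotient
  can be tested. Conversely, a violation with margin \<open>e\<close> yields points of
  \<open>C\<close> tending to \<open>z\<close> whose unit directions cluster, by compactness of the
  sphere, at a tangent vector \<open>v\<close> with \<open>e \<le> \<xi> \<bullet> v\<close>. This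
  is where finite dimension enters.\<close>

lemma frechet_normal_cone_eq_polar:
  fixes z :: "'a::euclidean_space"
  shows "frechet_normal_cone z C = {\<xi>. \<forall>v\<in>contingent_cone z C. \<xi> \<bullet> v \<le> 0}"
proof (intro set_eqI iffI)
  fix \<xi> assume \<xi>: "\<xi> \<in> frechet_normal_cone z C"
  have "\<xi> \<bullet> v \<le> 0" if v: "v \<in> contingent_cone z C" for v
  proof (cases "v = 0")
    case False
    from v obtain w t where w: "w \<longlonglongrightarrow> v" and t: "\<And>k. 0 < t k" "t \<longlonglongrightarrow> 0"
      and C: "\<And>k. z + t k *\<^sub>R w k \<in> C"
      unfolding contingent_cone_def by blast
    \<comment> \<open>The filter at \<open>z\<close> within \<open>C\<close> omits \<open>z\<close>
      itself, so the sequence has to avoid it; this is why \<open>v = 0\<close> is split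
      off.\<close>
    have w0: "\<forall>\<^sub>F k in sequentially. w k \<noteq> 0"
      using w False by (rule tendsto_imp_eventually_ne)
    have "(\<lambda>k. z + t k *\<^sub>R w k) \<longlonglongrightarrow> z + 0 *\<^sub>R v"
      by (intro tendsto_intros w t)
    then have "filterlim (\<lambda>k. z + t k *\<^sub>R w k) (at z within C) sequentially"
      unfolding filterlim_at using w0 C t(1) by (auto elim!: eventually_mono simp: less_imp_neq[symmetric])
    then have ev: "\<forall>\<^sub>F k in sequentially.
        \<xi> \<bullet> (z + t k *\<^sub>R w k - z) / norm (z + t k *\<^sub>R w k - z) < e" if "0 < e" for e
      using \<xi>[unfolded frechet_normal_cone_iff, rule_format, OF that]
      by (rule eventually_compose_filterlim[rotated])
    \<comment> \<open>The positive factor \<open>t k\<close> cancels from the quotient in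
      \<open>ev\<close>, which leaves the quotient used here.\<close>
    have lim: "(\<lambda>k. \<xi> \<bullet> w k / norm (w k)) \<longlonglongrightarrow> \<xi> \<bullet> v / norm v"
      using False by (intro tendsto_intros w) auto
    have "\<xi> \<bullet> v / norm v \<le> 0 + e" if "0 < e" for e
    proof (rule tendsto_upperbound[OF lim])
      show "\<forall>\<^sub>F k in sequentially. \<xi> \<bullet> w k / norm (w k) \<le> 0 + e"
        using ev[OF that]
      proof eventually_elim
        case (elim k)
        then show ?case using t(1)[of k] by simp
      qed
    qed simp
    then have "\<xi> \<bullet> v / norm v \<le> 0"
      by (rule field_le_epsilon)
    then show ?thesis
      using False by (simp add: divide_le_0_iff)
  qed simp
  then show "\<xi> \<in> {\<xi>. \<forall>v\<in>contingent_cone z C. \<xi> \<bullet> v \<le> 0}" by blast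
next
  fix \<xi> assume "\<xi> \<in> {\<xi>. \<forall>v\<in>contingent_cone z C. \<xi> \<bullet> v \<le> 0}"
  then have polar: "\<And>v. v \<in> contingent_cone z C \<Longrightarrow> \<xi> \<bullet> v \<le> 0" by blast
  show "\<xi> \<in> frechet_normal_cone z C"
  proof (rule ccontr)
    assume "\<xi> \<notin> frechet_normal_cone z C"
    then obtain e where "0 < e"
      and e: "\<not> (\<forall>\<^sub>F z' in at z within C. \<xi> \<bullet> (z' - z) / norm (z' - z) < e)"
      unfolding frechet_normal_cone_iff by blast
    have "\<exists>y\<in>C. y \<noteq> z \<and> dist y z < inverse (Suc k) \<and> e \<le> \<xi> \<bullet> (y - z) / norm (y - z)" for k
      using e unfolding eventually_at
      by (metis inverse_positive_iff_positive linorder_not_less of_nat_0_less_iff zero_less_Suc)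
    then obtain y where y: "\<And>k. y k \<in> C" "\<And>k. y k \<noteq> z"
      "\<And>k. dist (y k) z < inverse (Suc k)"
      "\<And>k. e \<le> \<xi> \<bullet> (y k - z) / norm (y k - z)"
      by metis
    \<comment> \<open>Directions of the sought tangent vector; the matching step sizes are the
      distances \<open>norm (y k - z)\<close>.\<close>
    define w where "w k = (y k - z) /\<^sub>R norm (y k - z)" for k
    have "\<forall>k. w k \<in> sphere 0 1"
      using y(2) by (auto simp: w_def)
    with compact_sphere[of 0 1] obtain v r where "strict_mono (r :: nat \<Rightarrow> nat)"
      and lim: "(w \<circ> r) \<longlonglongrightarrow> v"
      unfolding compact_def by metis
    have "(\<lambda>k. norm (y k - z)) \<longlonglongrightarrow> 0"
      using y(3) by (intro tendsto_sandwich[OF _ _ tendsto_const LIMSEQ_inverse_real_of_nat])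
        (auto simp: dist_norm less_imp_le)
    then have "((\<lambda>k. norm (y k - z)) \<circ> r) \<longlonglongrightarrow> 0"
      using \<open>strict_mono r\<close> by (rule LIMSEQ_subseq_LIMSEQ)
    moreover have "z + norm (y k - z) *\<^sub>R w k \<in> C" for k
      using y(1,2)[of k] by (simp add: w_def)
    ultimately have "v \<in> contingent_cone z C"
      unfolding contingent_cone_def mem_Collect_eq using lim y(2)
      by (intro exI[of _ "w \<circ> r"] exI[of _ "(\<lambda>k. norm (y k - z)) \<circ> r"]) auto
    moreover have "e \<le> \<xi> \<bullet> v"
      using y(4) by (intro tendsto_lowerbound[OF tendsto_inner[OF tendsto_const lim]])
        (auto simp: w_def divide_inverse mult.commute)
    ultimately show False
      using polar \<open>0 < e\<close> by fastforce
  qed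
qed

text \<open>Constant sequences make every element of \<open>K\<close> tangent at 0. Conversely, a
  tangent vector is a limit of \<open>w k\<close> with \<open>t k *\<^sub>R w k\<close> in
  \<open>K\<close>, and the polar inequality survives both the division by \<open>t k\<close> and
  the limit.\<close>

lemma frechet_normal_cone_0_eq_polar:
  assumes K: "\<And>u c. u \<in> K \<Longrightarrow> 0 < c \<Longrightarrow> c *\<^sub>R u \<in> K"
  shows "frechet_normal_cone (0::'a::euclidean_space) K = {\<xi>. \<forall>u\<in>K. \<xi> \<bullet> u \<le> 0}"
proof -
  have "u \<in> contingent_cone 0 K" if "u \<in> K" for u
    unfolding contingent_cone_def mem_Collect_eq using K[OF that]
    by (intro exI[of _ "\<lambda>_. u"] exI[of _ "\<lambda>k. inverse (real (Suc k))"])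
      (auto intro: LIMSEQ_inverse_real_of_nat simp del: of_nat_Suc)
  moreover have "\<xi> \<bullet> v \<le> 0" if \<xi>: "\<forall>u\<in>K. \<xi> \<bullet> u \<le> 0" and "v \<in> contingent_cone 0 K" for \<xi> v
  proof -
    from that(2) obtain w t where w: "w \<longlonglongrightarrow> v" and t: "\<And>k. 0 < t k"
      and C: "\<And>k. 0 + t k *\<^sub>R w k \<in> K"
      unfolding contingent_cone_def by blast
    have "\<xi> \<bullet> w k \<le> 0" for k
      using \<xi>[rule_format, OF C[of k]] t[of k] by (simp add: mult_le_0_iff)
    then show ?thesis
      by (intro tendsto_upperbound[OF tendsto_inner[OF tendsto_const w]]) auto
  qed
  ultimately show ?thesis
    unfolding frechet_normal_cone_eq_polar by blast
qed

lemma contingent_cone_scaleR: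
  assumes "v \<in> contingent_cone z C" "0 < c"
  shows "c *\<^sub>R v \<in> contingent_cone z C"
proof -
  from assms obtain w t where w: "w \<longlonglongrightarrow> v" and t: "\<And>k. 0 < t k" "t \<longlonglongrightarrow> 0"
    and C: "\<And>k. z + t k *\<^sub>R w k \<in> C"
    unfolding contingent_cone_def by blast
  have "(\<lambda>k. t k / c) \<longlonglongrightarrow> 0"
    using t(2) by (rule tendsto_divide_zero)
  moreover have "(\<lambda>k. c *\<^sub>R w k) \<longlonglongrightarrow> c *\<^sub>R v"
    by (intro tendsto_intros w)
  ultimately show ?thesis
    unfolding contingent_cone_def mem_Collect_eq using t C \<open>0 < c\<close>
    by (intro exI[of _ "\<lambda>k. c *\<^sub>R w k"] exI[of _ "\<lambda>k. t k / c"]) auto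
qed

lemma linearized_cone_scaleR:
  assumes "F differentiable at x" "u \<in> linearized_cone F \<Omega> x" "0 < c"
  shows "c *\<^sub>R u \<in> linearized_cone F \<Omega> x"
  using assms contingent_cone_scaleR linear_frechet_derivative[OF assms(1)]
  by (simp add: linearized_cone_def linear_scale)

text \<open>Differentiability in Hadamard form: the remainder is small relative to
  \<open>t k * norm (w k)\<close>, and \<open>norm (w k)\<close> converges. It serves both for the
  varying directions of a tangent sequence and for a constant direction.\<close>

lemma difference_quotient_tendsto:
  assumes D: "(F has_derivative D) (at x)"
    and w: "w \<longlonglongrightarrow> v" and t: "\<And>k. 0 < t k" "t \<longlonglongrightarrow> 0"
  shows "(\<lambda>k. (F (x + t k *\<^sub>R w k) - F x) /\<^sub>R t k) \<longlonglongrightarrow> D v"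
proof -
  interpret D: bounded_linear D using D by (rule has_derivative_bounded_linear)
  \<comment> \<open>Division by zero yields \<open>R 0 = 0\<close>, so the Frechet limit is exactly
    continuity of \<open>R\<close> at 0, and steps with \<open>w k = 0\<close> do no harm.\<close>
  define R where "R h = norm (F (x + h) - F x - D h) / norm h" for h
  have "isCont R 0"
    using D unfolding has_derivative_at isCont_def R_def by simp
  moreover have "(\<lambda>k. t k *\<^sub>R w k) \<longlonglongrightarrow> 0"
    using tendsto_scaleR[OF t(2) w] by simp
  ultimately have R: "(\<lambda>k. R (t k *\<^sub>R w k)) \<longlonglongrightarrow> R 0"
    by (rule isCont_tendsto_compose)
  let ?q = "\<lambda>k. (F (x + t k *\<^sub>R w k) - F x) /\<^sub>R t k"
  have "norm (?q k - D (w k)) = norm (w k) * R (t k *\<^sub>R w k)" for k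
  proof -
    have "?q k - D (w k) = (F (x + t k *\<^sub>R w k) - F x - D (t k *\<^sub>R w k)) /\<^sub>R t k"
      using t(1)[of k] by (simp add: D.scaleR scaleR_diff_right)
    then show ?thesis
      using t(1)[of k] by (cases "w k = 0") (simp_all add: R_def D.zero divide_inverse)
  qed
  then have "(\<lambda>k. norm (?q k - D (w k))) \<longlonglongrightarrow> norm v * R 0"
    using tendsto_mult[OF tendsto_norm[OF w] R] by simp
  then have "(\<lambda>k. ?q k - D (w k)) \<longlonglongrightarrow> 0"
    by (simp add: R_def tendsto_norm_zero_iff)
  from tendsto_add[OF this D.tendsto[OF w]] show ?thesis by simp
qed

text \<open>With unchanged step sizes, the difference quotients of \<open>F\<close> along a tangent
  sequence witness tangency of the image vector to \<Omega>.\<close>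

lemma contingent_cone_feasible_subset_linearized:
  assumes "F differentiable at x"
  shows "contingent_cone x (feasible_set F \<Omega>) \<subseteq> linearized_cone F \<Omega> x"
proof
  fix v assume "v \<in> contingent_cone x (feasible_set F \<Omega>)"
  then obtain w t where w: "w \<longlonglongrightarrow> v" and t: "\<And>k. 0 < t k" "t \<longlonglongrightarrow> 0"
    and C: "\<And>k. F (x + t k *\<^sub>R w k) \<in> \<Omega>"
    unfolding contingent_cone_def feasible_set_def by blast
  define q where "q k = (F (x + t k *\<^sub>R w k) - F x) /\<^sub>R t k" for k
  have "q \<longlonglongrightarrow> frechet_derivative F (at x) v"
    unfolding q_def using assms w t
    by (intro difference_quotient_tendsto) (auto simp: frechet_derivative_works)
  moreover have "F x + t k *\<^sub>R q k \<in> \<Omega>" for k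
    using C[of k] t(1)[of k] by (simp add: q_def)
  ultimately show "v \<in> linearized_cone F \<Omega> x"
    unfolding linearized_cone_def contingent_cone_def using t by blast
qed

text \<open>On the ray through \<open>u\<close> the angular deviation vanishes, which leaves only
  the radius to check.\<close>

lemma scaleR_mem_dir_nbhd:
  assumes "0 \<le> t" "t * norm u \<le> \<rho>" "0 < \<delta>"
  shows "t *\<^sub>R u \<in> dir_nbhd \<rho> \<delta> u"
  using assms by (simp add: dir_nbhd_def mult.commute)

lemma subregular_dir_imp_contingent:
  assumes diff: "F differentiable at x" and x: "x \<in> feasible_set F \<Omega>"
    and u: "u \<in> linearized_cone F \<Omega> x"
    and sub: "metrically_subregular_dir (constraint_map F \<Omega>) x u"
  shows "u \<in> contingent_cone x (feasible_set F \<Omega>)"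
proof -
  let ?S = "feasible_set F \<Omega>" and ?D = "frechet_derivative F (at x)"
  have inv: "{x'. 0 \<in> constraint_map F \<Omega> x'} = ?S"
    by (auto simp: constraint_map_def feasible_set_def)
  from sub obtain \<rho> \<delta> \<kappa> where pos: "0 < \<rho>" "0 < \<delta>" "0 < \<kappa>"
    and reg: "\<And>z. z \<in> dir_nbhd \<rho> \<delta> u \<Longrightarrow>
      infdist (x + z) ?S \<le> \<kappa> * infdist 0 (constraint_map F \<Omega> (x + z))"
    unfolding metrically_subregular_dir_def inv by blast
  from u obtain w t where w: "w \<longlonglongrightarrow> ?D u" and t: "\<And>k. 0 < t k" "t \<longlonglongrightarrow> 0"
    and C: "\<And>k. F x + t k *\<^sub>R w k \<in> \<Omega>"
    unfolding linearized_cone_def contingent_cone_def by blast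
  define q where "q k = (F (x + t k *\<^sub>R u) - F x) /\<^sub>R t k" for k
  have q: "q \<longlonglongrightarrow> ?D u"
    unfolding q_def using diff t
    by (intro difference_quotient_tendsto) (auto simp: frechet_derivative_works)
  \<comment> \<open>Near-projections onto the feasible set, since the infimum need not be attained
    for arbitrary \<Omega>. The slack \<open>t k * t k\<close> is positive and still tends to 0
    after division by \<open>t k\<close>.\<close>
  have "\<exists>y\<in>?S. dist (x + t k *\<^sub>R u) y < infdist (x + t k *\<^sub>R u) ?S + t k * t k" for k
  proof -
    have S: "dist (x + t k *\<^sub>R u) ` ?S \<noteq> {}"
      using x by blast
    then have "(INF y\<in>?S. dist (x + t k *\<^sub>R u) y) < infdist (x + t k *\<^sub>R u) ?S + t k * t k"
      using t(1)[of k] by (simp add: infdist_notempty)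
    from cInf_lessD[OF S this] show ?thesis
      by (elim bexE imageE) auto
  qed
  then obtain y where y: "\<And>k. y k \<in> ?S"
    "\<And>k. dist (x + t k *\<^sub>R u) (y k) < infdist (x + t k *\<^sub>R u) ?S + t k * t k"
    by metis
  \<comment> \<open>Chosen so that \<open>x + t k *\<^sub>R v k\<close> is the feasible point
    \<open>y k\<close>; it remains to show that \<open>v\<close> tends to \<open>u\<close>.\<close>
  define v where "v k = (y k - x) /\<^sub>R t k" for k
  \<comment> \<open>Subregularity is available only within radius \<rho>, so the bound holds only
    eventually.\<close>
  have "(\<lambda>k. t k * norm u) \<longlonglongrightarrow> 0"
    using t(2) by (rule tendsto_mult_left_zero)
  then have "\<forall>\<^sub>F k in sequentially. t k * norm u < \<rho>"
    using pos(1) by (rule order_tendstoD)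
  then have bound: "\<forall>\<^sub>F k in sequentially. norm (v k - u) \<le> \<kappa> * norm (q k - w k) + t k"
  proof eventually_elim
    case (elim k)
    have tk: "0 < t k" by (rule t)
    \<comment> \<open>The point \<open>F x + t k *\<^sub>R w k\<close> of \<Omega> bounds the
      residual by \<open>t k * norm (q k - w k)\<close>.\<close>
    have "F (x + t k *\<^sub>R u) - (F x + t k *\<^sub>R w k) \<in> constraint_map F \<Omega> (x + t k *\<^sub>R u)"
      using C by (auto simp: constraint_map_def)
    then have "infdist 0 (constraint_map F \<Omega> (x + t k *\<^sub>R u))
        \<le> dist 0 (F (x + t k *\<^sub>R u) - (F x + t k *\<^sub>R w k))"
      by (rule infdist_le)
    also have "F (x + t k *\<^sub>R u) - (F x + t k *\<^sub>R w k) = t k *\<^sub>R (q k - w k)"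
      using tk by (simp add: q_def algebra_simps)
    finally have "infdist 0 (constraint_map F \<Omega> (x + t k *\<^sub>R u)) \<le> t k * norm (q k - w k)"
      using tk by simp
    moreover have "t k *\<^sub>R u \<in> dir_nbhd \<rho> \<delta> u"
      using elim tk pos by (intro scaleR_mem_dir_nbhd) auto
    ultimately have "infdist (x + t k *\<^sub>R u) ?S \<le> \<kappa> * (t k * norm (q k - w k))"
      using reg pos(3) by (meson mult_left_mono less_imp_le order_trans)
    then have "dist (x + t k *\<^sub>R u) (y k) \<le> t k * (\<kappa> * norm (q k - w k) + t k)"
      using y(2)[of k] by (simp add: algebra_simps)
    moreover have "dist (x + t k *\<^sub>R u) (y k) = t k * norm (v k - u)"
    proof -
      have "y k - (x + t k *\<^sub>R u) = t k *\<^sub>R (v k - u)"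
        using tk by (simp add: v_def algebra_simps)
      then show ?thesis
        using tk by (metis abs_of_pos dist_commute dist_norm norm_scaleR)
    qed
    ultimately show ?case
      using tk by simp
  qed
  \<comment> \<open>\<open>q\<close> and \<open>w\<close> share the limit \<open>?D u\<close>: one
    by differentiability, the other by tangency to \<Omega>.\<close>
  have "(\<lambda>k. \<kappa> * norm (q k - w k) + t k) \<longlonglongrightarrow> \<kappa> * norm (?D u - ?D u) + 0"
    by (intro tendsto_intros q w t)
  then have "(\<lambda>k. \<kappa> * norm (q k - w k) + t k) \<longlonglongrightarrow> 0" by simp
  with bound have "(\<lambda>k. v k - u) \<longlonglongrightarrow> 0"
    by (rule Lim_null_comparison)
  then have "v \<longlonglongrightarrow> u"
    by (simp add: LIM_zero_iff)
  moreover have "x + t k *\<^sub>R v k \<in> ?S" for k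
    using y(1)[of k] t(1)[of k] by (simp add: v_def)
  ultimately show ?thesis
    unfolding contingent_cone_def using t by blast
qed

theorem proposition3p12:
  fixes F :: "real ^ 'n \<Rightarrow> real ^ 'm"
    and \<Omega> :: "(real ^ 'm) set"
    and \<P> :: "(real ^ 'm) set set"
    and xbar :: "real ^ 'n"
  assumes "continuously_differentiable F"
    and "finite \<P>" and "\<And>P. P \<in> \<P> \<Longrightarrow> polyhedron P" and "\<Omega> = \<Union>\<P>"
    and "xbar \<in> feasible_set F \<Omega>"
    and "WDMSCQ F \<Omega> xbar"
  shows "GGCQ F \<Omega> xbar"
proof -
  have diff: "F differentiable at xbar"
    using assms(1) unfolding continuously_differentiable_def differentiable_def by blast
  let ?T = "contingent_cone xbar (feasible_set F \<Omega>)" and ?L = "linearized_cone F \<Omega> xbar"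
  from assms(6) obtain U where U: "U \<subseteq> ?L"
    and hull: "convex hull ?L = {(\<Sum>u\<in>U. \<alpha> u *\<^sub>R u) |\<alpha>. \<forall>u\<in>U. 0 \<le> \<alpha> u}"
    and sub: "\<And>u. u \<in> U \<Longrightarrow> metrically_subregular_dir (constraint_map F \<Omega>) xbar u"
    unfolding WDMSCQ_def by blast
  have UT: "U \<subseteq> ?T"
    using subregular_dir_imp_contingent[OF diff assms(5)] U sub by blast
  \<comment> \<open>Tangency is known only for the generators, but every \<open>v\<close> in
    \<open>?L\<close> is a nonnegative combination of them, so the sign of the inner product carries
    over.\<close>
  have "\<xi> \<bullet> v \<le> 0" if \<xi>: "\<forall>v\<in>?T. \<xi> \<bullet> v \<le> 0" and "v \<in> ?L" for \<xi> v
  proof -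
    have "v \<in> convex hull ?L"
      using \<open>v \<in> ?L\<close> by (rule hull_inc)
    then obtain \<alpha> where v: "v = (\<Sum>u\<in>U. \<alpha> u *\<^sub>R u)" and "\<forall>u\<in>U. 0 \<le> \<alpha> u"
      unfolding hull by blast
    then show ?thesis
      using \<xi> UT by (auto simp: inner_sum_right intro!: sum_nonpos mult_nonneg_nonpos)
  qed
  \<comment> \<open>The other inclusion holds because taking polars reverses
    \<open>?T \<subseteq> ?L\<close>.\<close>
  then have "{\<xi>. \<forall>v\<in>?T. \<xi> \<bullet> v \<le> 0} = {\<xi>. \<forall>v\<in>?L. \<xi> \<bullet> v \<le> 0}"
    using contingent_cone_feasible_subset_linearized[OF diff] by blast
  moreover have "frechet_normal_cone 0 ?L = {\<xi>. \<forall>v\<in>?L. \<xi> \<bullet> v \<le> 0}"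
    by (rule frechet_normal_cone_0_eq_polar) (rule linearized_cone_scaleR[OF diff])
  ultimately show ?thesis
    by (simp add: GGCQ_def frechet_normal_cone_eq_polar[of xbar])
qed

end
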